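(* Let $J \in \{\mathbb{R}_+, \mathbb{R}\}$ and let $f : J \to \mathbb{R}$ be an arbitrary real-valued function. Then: (i) $J(f;\varepsilon)$ is at most countable for all $\varepsilon > 0$. (ii) There exists a partition $\{D_k : k \in \mathbb{N}\}$ of $J(f)$ such that each $D_k$ is a finite subset of $J(f)$. In particular, $J(f)$ is at most countable.
   Context: $\mathbb{R}_+ = [0,\infty)$. For $f : J \to \mathbb{R}$, $f(t+)$ and $f(t-)$ denote the finite right-hand and left-hand limits of $f$ at $t$ (taken over $s > t$, respectively $s < t$), when they exist in $\mathbb{R}$. $L(f)$ is the set of all $t$ in the interior of $J$ such that both $f(t+)$ and $f(t-)$ exist in $\mathbb{R}$. For $t \in L(f)$, $\Delta f(t) := f(t+) - f(t-)$. $J(f;\varepsilon) := \{t \in L(f) : |\Delta f(t)| \geq \varepsilon\}$ and $J(f) := \{t \in L(f) : \Delta f(t) \neq 0\}$. A partition $\{D_k : k \in \mathbb{N}\}$ of a set $D$ means a sequence of pairwise disjoint (possibly empty) sets with union $D$. *)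

theory Defs
  imports "HOL-Analysis.Analysis"
begin

text \<open>
  A function \<open>f : J \<rightarrow> \<real>\<close> is a total function \<open>f :: real \<Rightarrow> real\<close> together with its domain \<open>J\<close>.
  One-sided limits are taken only over points of \<open>J\<close>, so the values of \<open>f\<close> outside \<open>J\<close> are never used.
\<close>

definition has_right_limit :: "real set \<Rightarrow> (real \<Rightarrow> real) \<Rightarrow> real \<Rightarrow> bool" where
  "has_right_limit J f t \<longleftrightarrow> (\<exists>l. (f \<longlongrightarrow> l) (at t within J \<inter> {t<..}))"

definition has_left_limit :: "real set \<Rightarrow> (real \<Rightarrow> real) \<Rightarrow> real \<Rightarrow> bool" where
  "has_left_limit J f t \<longleftrightarrow> (\<exists>l. (f \<longlongrightarrow> l) (at t within J \<inter> {..<t}))"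

text \<open>
  The next three constants are meaningful only where the limits exist. Below they are used only
  on \<open>limit_points J f\<close>, whose points are interior to \<open>J\<close>, so that both filters are
  nontrivial and the limits are unique.
\<close>

definition right_limit :: "real set \<Rightarrow> (real \<Rightarrow> real) \<Rightarrow> real \<Rightarrow> real" where
  "right_limit J f t = Lim (at t within J \<inter> {t<..}) f"

definition left_limit :: "real set \<Rightarrow> (real \<Rightarrow> real) \<Rightarrow> real \<Rightarrow> real" where
  "left_limit J f t = Lim (at t within J \<inter> {..<t}) f"

definition jump :: "real set \<Rightarrow> (real \<Rightarrow> real) \<Rightarrow> real \<Rightarrow> real" where
  "jump J f t = right_limit J f t - left_limit J f t"

text \<open>The set \<open>L(f)\<close>.\<close>

definition limit_points :: "real set \<Rightarrow> (real \<Rightarrow> real) \<Rightarrow> real set" where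
  "limit_points J f = {t \<in> interior J. has_right_limit J f t \<and> has_left_limit J f t}"

text \<open>The sets \<open>J(f;\<epsilon>)\<close> and \<open>J(f)\<close>.\<close>

definition jumps_ge :: "real set \<Rightarrow> (real \<Rightarrow> real) \<Rightarrow> real \<Rightarrow> real set" where
  "jumps_ge J f \<epsilon> = {t \<in> limit_points J f. \<bar>jump J f t\<bar> \<ge> \<epsilon>}"

definition jumps :: "real set \<Rightarrow> (real \<Rightarrow> real) \<Rightarrow> real set" where
  "jumps J f = {t \<in> limit_points J f. jump J f t \<noteq> 0}"

text \<open>A partition in which the pieces may be empty.\<close>

definition is_seq_partition :: "(nat \<Rightarrow> 'a set) \<Rightarrow> 'a set \<Rightarrow> bool" where
  "is_seq_partition D A \<longleftrightarrow> disjoint_family D \<and> (\<Union>k. D k) = A"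

end

theory Submission
  imports Defs
begin

text \<open>
  Everything rests on the fact that each \<open>J(f;\<epsilon>)\<close> is a discrete set. If \<open>f(t+)\<close> exists, then
  immediately to the right of \<open>t\<close> the function \<open>f\<close> is confined to a band of radius \<open>\<epsilon>/3\<close> about
  \<open>f(t+)\<close>. One-sided limits at points of that open interval are limits of values in the band, so
  jumps there have size at most \<open>2\<epsilon>/3 < \<epsilon>\<close> (\<open>abs_jump_le_of_band\<close>). The same holds to the left
  of \<open>t\<close>, so \<open>t\<close> is the only possible element of \<open>J(f;\<epsilon>)\<close> in some neighbourhood of \<open>t\<close>
  (\<open>jumps_ge_discrete\<close>). The set \<open>J(f;\<epsilon>)\<close> may accumulate at points outside \<open>L(f)\<close>, so it
  need not meet compact intervals in finite sets; but a discrete subset of a second countable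
  space is countable by the Lindelof property (\<open>discrete_imp_countable\<close>).

  Countability of \<open>J(f)\<close> follows by letting \<open>\<epsilon>\<close> run through \<open>1/(n+1)\<close>, and any countable set
  splits into the fibres of an injection into \<open>\<nat>\<close>, each of which has at most one element.
\<close>

text \<open>
  Discreteness covers \<open>S\<close> by open sets that meet it in finite sets, and the Lindelof property
  leaves countably many of them.
\<close>

lemma discrete_imp_countable:
  fixes S :: "'a::second_countable_topology set"
  assumes "discrete S"
  shows "countable S"
proof -
  define \<F> where "\<F> = {T. open T \<and> finite (T \<inter> S)}"
  obtain \<G> where \<G>: "\<G> \<subseteq> \<F>" "countable \<G>" "\<Union>\<G> = \<Union>\<F>"
    using Lindelof[of \<F>] unfolding \<F>_def by blast
  have "S \<subseteq> \<Union>\<F>"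
  proof
    fix x assume "x \<in> S"
    then obtain T where "open T" "T \<inter> S = {x}"
      using discreteD[OF assms] unfolding isolated_in_def by blast
    then show "x \<in> \<Union>\<F>" unfolding \<F>_def by auto
  qed
  then have "S = (\<Union>T\<in>\<G>. T \<inter> S)"
    using \<G>(3) by blast
  moreover have "countable (\<Union>T\<in>\<G>. T \<inter> S)"
    using \<G>(1,2) unfolding \<F>_def by (intro countable_UN) (auto intro: countable_finite)
  ultimately show ?thesis by simp
qed

lemma countable_imp_seq_partition_finite:
  assumes "countable A"
  shows "\<exists>D. is_seq_partition D A \<and> (\<forall>k. finite (D k) \<and> D k \<subseteq> A)"
proof -
  define D where "D = (\<lambda>k. {x \<in> A. to_nat_on A x = k})"
  have "finite (D k)" for k
  proof (rule finite_subset)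
    show "D k \<subseteq> {from_nat_into A k}"
      using assms unfolding D_def by auto
  qed simp
  moreover have "is_seq_partition D A"
    unfolding is_seq_partition_def disjoint_family_on_def D_def by auto
  ultimately show ?thesis
    unfolding D_def by blast
qed

lemma
  fixes t :: real
  assumes "t \<in> interior J"
  shows at_right_within_nontrivial: "at t within J \<inter> {t<..} \<noteq> bot"
    and at_left_within_nontrivial: "at t within J \<inter> {..<t} \<noteq> bot"
proof -
  have "at t within J \<inter> A = at t within A" for A
    by (rule at_within_nhd[of t "interior J"]) (use assms interior_subset[of J] in auto)
  then show "at t within J \<inter> {t<..} \<noteq> bot" "at t within J \<inter> {..<t} \<noteq> bot"
    by simp_all
qed

lemma tendsto_right_limit:
  assumes "t \<in> limit_points J f"
  shows "(f \<longlongrightarrow> right_limit J f t) (at t within J \<inter> {t<..})"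
  using assms tendsto_Lim[OF at_right_within_nontrivial]
  unfolding limit_points_def has_right_limit_def right_limit_def by fastforce

lemma tendsto_left_limit:
  assumes "t \<in> limit_points J f"
  shows "(f \<longlongrightarrow> left_limit J f t) (at t within J \<inter> {..<t})"
  using assms tendsto_Lim[OF at_left_within_nontrivial]
  unfolding limit_points_def has_left_limit_def left_limit_def by fastforce

text \<open>
  Both one-sided limits at a point of \<open>U\<close> are limits of values of \<open>f\<close> in the closed band, hence
  lie in it themselves; the jump is at most its width.
\<close>

lemma abs_jump_le_of_band:
  assumes s: "s \<in> limit_points J f" and U: "open U" "s \<in> U"
    and band: "\<And>x. x \<in> J \<inter> U \<Longrightarrow> f x \<in> cball l r"
  shows "\<bar>jump J f s\<bar> \<le> 2 * r"
proof -
  have s_int: "s \<in> interior J" using s unfolding limit_points_def by simp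
  have ev: "\<forall>\<^sub>F x in at s within J \<inter> A. f x \<in> cball l r" for A
    unfolding eventually_at_topological using U band by blast
  have "right_limit J f s \<in> cball l r"
    using Lim_in_closed_set[OF closed_cball ev at_right_within_nontrivial[OF s_int]
        tendsto_right_limit[OF s]] .
  moreover have "left_limit J f s \<in> cball l r"
    using Lim_in_closed_set[OF closed_cball ev at_left_within_nontrivial[OF s_int]
        tendsto_left_limit[OF s]] .
  ultimately show ?thesis
    unfolding jump_def by (auto simp: dist_real_def)
qed

text \<open>
  Stated for an arbitrary open \<open>A\<close> so that it serves both half-lines \<open>{t<..}\<close> and \<open>{..<t}\<close>.
\<close>

lemma tendsto_imp_no_large_jumps_near:
  assumes "\<epsilon> > 0" "open A" and lim: "(f \<longlongrightarrow> l) (at t within J \<inter> A)"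
  shows "\<exists>T. open T \<and> t \<in> T \<and> T \<inter> A \<inter> jumps_ge J f \<epsilon> \<subseteq> {t}"
proof -
  have "\<forall>\<^sub>F x in at t within J \<inter> A. dist (f x) l < \<epsilon>/3"
    using tendstoD[OF lim, of "\<epsilon>/3"] \<open>\<epsilon> > 0\<close> by simp
  then obtain T where T: "open T" "t \<in> T"
      "\<And>x. x \<in> T \<Longrightarrow> x \<noteq> t \<Longrightarrow> x \<in> J \<inter> A \<Longrightarrow> dist (f x) l < \<epsilon>/3"
    unfolding eventually_at_topological by blast
  have "s = t" if "s \<in> T \<inter> A" "s \<in> jumps_ge J f \<epsilon>" for s
  proof (rule ccontr)
    assume "s \<noteq> t"
    have "\<bar>jump J f s\<bar> \<le> 2 * (\<epsilon>/3)"
    proof (rule abs_jump_le_of_band)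
      show "s \<in> limit_points J f" using that unfolding jumps_ge_def by simp
      show "open (T \<inter> A - {t})" using T \<open>open A\<close> by (intro open_Diff) auto
      show "s \<in> T \<inter> A - {t}" using that \<open>s \<noteq> t\<close> by simp
      show "f x \<in> cball l (\<epsilon>/3)" if "x \<in> J \<inter> (T \<inter> A - {t})" for x
        using T(3)[of x] that by (simp add: dist_commute)
    qed
    moreover have "\<epsilon> \<le> \<bar>jump J f s\<bar>" using that unfolding jumps_ge_def by simp
    ultimately show False using \<open>\<epsilon> > 0\<close> by simp
  qed
  then show ?thesis using T(1,2) by blast
qed

lemma jumps_ge_discrete:
  assumes "\<epsilon> > 0"
  shows "discrete (jumps_ge J f \<epsilon>)"
proof (rule discreteI)
  fix t assume t: "t \<in> jumps_ge J f \<epsilon>"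
  then have tL: "t \<in> limit_points J f" unfolding jumps_ge_def by simp
  obtain R where R: "open R" "t \<in> R" "R \<inter> {t<..} \<inter> jumps_ge J f \<epsilon> \<subseteq> {t}"
    using tendsto_imp_no_large_jumps_near[OF assms _ tendsto_right_limit[OF tL]] by auto
  obtain L where L: "open L" "t \<in> L" "L \<inter> {..<t} \<inter> jumps_ge J f \<epsilon> \<subseteq> {t}"
    using tendsto_imp_no_large_jumps_near[OF assms _ tendsto_left_limit[OF tL]] by auto
  have "s = t" if "s \<in> R \<inter> L" "s \<in> jumps_ge J f \<epsilon>" for s
    using that R(3) L(3) by (cases s t rule: linorder_cases) auto
  then have "(R \<inter> L) \<inter> jumps_ge J f \<epsilon> = {t}"
    using t R(2) L(2) by blast
  then show "t isolated_in jumps_ge J f \<epsilon>"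
    using t R(1) L(1) by (intro isolated_inI[of _ _ "R \<inter> L"]) auto
qed

lemma countable_jumps_ge:
  assumes "\<epsilon> > 0"
  shows "countable (jumps_ge J f \<epsilon>)"
  using discrete_imp_countable[OF jumps_ge_discrete[OF assms]] .

lemma jumps_eq_UN_jumps_ge: "jumps J f = (\<Union>n. jumps_ge J f (inverse (real (Suc n))))"
proof (intro equalityI subsetI)
  fix t assume t: "t \<in> jumps J f"
  then have "\<bar>jump J f t\<bar> > 0" unfolding jumps_def by simp
  then obtain n where "inverse (real (Suc n)) < \<bar>jump J f t\<bar>"
    using reals_Archimedean by blast
  then have "t \<in> jumps_ge J f (inverse (real (Suc n)))"
    using t unfolding jumps_def jumps_ge_def by simp
  then show "t \<in> (\<Union>n. jumps_ge J f (inverse (real (Suc n))))"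
    by blast
next
  fix t assume "t \<in> (\<Union>n. jumps_ge J f (inverse (real (Suc n))))"
  then obtain n where n: "t \<in> limit_points J f" "inverse (real (Suc n)) \<le> \<bar>jump J f t\<bar>"
    unfolding jumps_ge_def by blast
  moreover have "0 < inverse (real (Suc n))" by simp
  ultimately show "t \<in> jumps J f" unfolding jumps_def by auto
qed

theorem theorem2p6:
  fixes J :: "real set" and f :: "real \<Rightarrow> real"
  assumes "J \<in> {{0..}, UNIV}"
  shows "(\<forall>\<epsilon>>0. countable (jumps_ge J f \<epsilon>)) \<and>
         (\<exists>D. is_seq_partition D (jumps J f) \<and> (\<forall>k. finite (D k) \<and> D k \<subseteq> jumps J f)) \<and>
         countable (jumps J f)"
proof -
  have "countable (jumps J f)"
    unfolding jumps_eq_UN_jumps_ge by (intro countable_UN countable_jumps_ge) auto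
  then show ?thesis
    using countable_jumps_ge countable_imp_seq_partition_finite by blast
qed

end
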